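(* Let $n \geq 2$. If $(\mathcal{Q},\mathcal{P})$ is a misère quotient that is a one-stage extension of $\mathcal{R}_{2^n+4}$ and $|\mathcal{P}| = 2$, then $(\mathcal{Q},\mathcal{P}) \cong \mathcal{R}_{2^{n+1}+4}$.
   Context: Impartial games, misère outcomes, closed sets of games and misère quotients: a game is the set of its options; $0=\emptyset$; $G+H$ has options $G'+H$, $G+H'$; $G$ is a (misère) $\mathscr{P}$-position iff $G\ne0$ and all options are $\mathscr{N}$-positions. A set of games is closed if it contains $0$ and is closed under options and sums. For closed $\mathscr{A}$, $G\equiv_\mathscr{A}H$ iff $G+X,H+X$ have the same outcome for all $X\in\mathscr{A}$; $\mathcal{Q}(\mathscr{A})=\mathscr{A}/{\equiv_\mathscr{A}}$ with distinguished subset the classes of $\mathscr{P}$-positions. A bipartite monoid is a commutative monoid $\mathcal{Q}$ with a distinguished subset $\mathcal{P}$; isomorphisms preserve the subset; it is a misère quotient if isomorphic to some $\mathcal{Q}(\mathscr{A})$. Two elements $x,y$ of a bipartite monoid are indistinguishable if $xw\in\mathcal{P}\Leftrightarrow yw\in\mathcal{P}$ for all $w$; the reduction is the quotient by this congruence, and the bipartite monoid is reduced if this congruence is equality. $(\mathcal{S},\mathcal{R})$ is a sub-b.m. of $(\mathcal{Q}^+,\mathcal{P}^+)$ if $\mathcal{S}$ is a submonoid and $\mathcal{R}=\mathcal{P}^+\cap\mathcal{S}$. For reduced $(\mathcal{Q},\mathcal{P})$, $(\mathcal{Q}^+,\mathcal{P}^+)$: the latter is an extension of the former if there is a sub-b.m.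 $(\mathcal{S},\mathcal{R})$ of $(\mathcal{Q}^+,\mathcal{P}^+)$ whose reduction is isomorphic to $(\mathcal{Q},\mathcal{P})$; it is a one-stage extension if moreover $\mathcal{Q}^+$ is generated by $\mathcal{S}\cup\{x\}$ for a single $x\in\mathcal{Q}^+\setminus\mathcal{S}$. For $k\ge2$, $\mathcal{T}_k$ has distinct elements $1,a,z_0,\ldots,z_{2^k-1}$, identity $1$, $a^2=1$, $z_iz_j=z_{i\oplus j}$, $az_i=z_{i\oplus1}$ ($\oplus$ = bitwise XOR), distinguished subset $\{a,z_0\}$. $\mathcal{R}_{2^k+4}$ has underlying set $\mathcal{T}_k\cup\{t,at\}$ with multiplication extending that of $\mathcal{T}_k$ by $t\cdot1=t$, $t\cdot a=at$, $t^2=z_0$, $tz_i=z_i$ (hence $(at)a=t$, $(at)t=z_1$, $(at)^2=z_0$, $(at)z_i=z_{i\oplus1}$), distinguished subset $\{a,z_0\}$. *)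

theory Defs
  imports "HOL.Hull" "HOL-Algebra.Group" "HOL-Library.FSet"
begin

unbundle bit_operations_syntax

section \<open>Impartial games\<close>

text \<open>A game is identified with the (finite) set of its options, so the type below consists of the
  hereditarily finite sets and equality of games is extensional.\<close>

datatype game = Game (opts: "game fset")

definition zero_game :: game where
  "zero_game = Game {||}"

definition option_rel :: "(game \<times> game) set" where
  "option_rel = {(G', G). G' |\<in>| opts G}"

lemma wf_option_rel: "wf option_rel"
proof (rule wfUNIVI)
  fix P :: "game \<Rightarrow> bool" and G
  assume step: "\<forall>G. (\<forall>G'. (G', G) \<in> option_rel \<longrightarrow> P G') \<longrightarrow> P G"
  show "P G"
    by (induction G) (use step in \<open>auto simp: option_rel_def\<close>)
qed

lemma fimage_fundef_cong [fundef_cong]: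
  "A = B \<Longrightarrow> (\<And>x. x |\<in>| B \<Longrightarrow> f x = g x) \<Longrightarrow> f |`| A = g |`| B"
  by auto

function game_sum :: "game \<Rightarrow> game \<Rightarrow> game" where
  "game_sum G H =
     Game ((\<lambda>G'. game_sum G' H) |`| opts G |\<union>| (\<lambda>H'. game_sum G H') |`| opts H)"
  by pat_completeness auto
termination
  by (relation "option_rel <*lex*> option_rel")
     (auto intro: wf_option_rel, auto simp: option_rel_def)

declare game_sum.simps [simp del]

text \<open>Every game is either a P-position or an N-position, so being an N-position is the negation
  of the following predicate.\<close>

function misere_P :: "game \<Rightarrow> bool" where
  "misere_P G \<longleftrightarrow> G \<noteq> zero_game \<and> fBall (opts G) (\<lambda>G'. \<not> misere_P G')"
  by pat_completeness auto
termination
  by (relation option_rel) (auto intro: wf_option_rel, auto simp: option_rel_def)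

declare misere_P.simps [simp del]

definition closed_games :: "game set \<Rightarrow> bool" where
  "closed_games \<A> \<longleftrightarrow>
     zero_game \<in> \<A> \<and>
     (\<forall>G\<in>\<A>. fset (opts G) \<subseteq> \<A>) \<and>
     (\<forall>G\<in>\<A>. \<forall>H\<in>\<A>. game_sum G H \<in> \<A>)"

section \<open>Bipartite monoids\<close>

record 'a bip_monoid = "'a monoid" +
  distinguished :: "'a set"  (\<open>\<P>\<index>\<close>)

locale bipartite_monoid = comm_monoid Q for Q (structure) +
  assumes distinguished_subset: "\<P> \<subseteq> carrier Q"

definition bm_iso :: "('a, 'c) bip_monoid_scheme \<Rightarrow> ('b, 'd) bip_monoid_scheme \<Rightarrow> bool"
    (infix \<open>\<cong>\<^sub>b\<^sub>m\<close> 60) where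
  "Q \<cong>\<^sub>b\<^sub>m Q' \<longleftrightarrow> (\<exists>h\<in>iso Q Q'. h ` \<P>\<^bsub>Q\<^esub> = \<P>\<^bsub>Q'\<^esub>)"

text \<open>Quotient by a congruence \<open>r\<close>. For a congruence, all the sets united in the definition of the
  product coincide, so the union is the class of the product of any two representatives.\<close>

definition quotient_bm :: "('a, 'c) bip_monoid_scheme \<Rightarrow> ('a \<times> 'a) set \<Rightarrow> 'a set bip_monoid" where
  "quotient_bm Q r =
     \<lparr> carrier = carrier Q // r,
       mult = (\<lambda>X Y. \<Union>x\<in>X. \<Union>y\<in>Y. r `` {x \<otimes>\<^bsub>Q\<^esub> y}),
       one = r `` {\<one>\<^bsub>Q\<^esub>},
       distinguished = {r `` {p} | p. p \<in> \<P>\<^bsub>Q\<^esub>} \<rparr>"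

definition indist :: "('a, 'c) bip_monoid_scheme \<Rightarrow> ('a \<times> 'a) set" where
  "indist Q =
     {(x, y). x \<in> carrier Q \<and> y \<in> carrier Q \<and>
        (\<forall>w\<in>carrier Q. x \<otimes>\<^bsub>Q\<^esub> w \<in> \<P>\<^bsub>Q\<^esub> \<longleftrightarrow> y \<otimes>\<^bsub>Q\<^esub> w \<in> \<P>\<^bsub>Q\<^esub>)}"

definition reduction :: "('a, 'c) bip_monoid_scheme \<Rightarrow> 'a set bip_monoid" where
  "reduction Q = quotient_bm Q (indist Q)"

definition reduced :: "('a, 'c) bip_monoid_scheme \<Rightarrow> bool" where
  "reduced Q \<longleftrightarrow> indist Q = Id_on (carrier Q)"

text \<open>The sub-bipartite-monoid carried by a submonoid \<open>S\<close>.\<close>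

definition sub_bm :: "'a bip_monoid \<Rightarrow> 'a set \<Rightarrow> 'a bip_monoid" where
  "sub_bm Q S = Q \<lparr> carrier := S, distinguished := \<P>\<^bsub>Q\<^esub> \<inter> S \<rparr>"

definition extension_via :: "'a bip_monoid \<Rightarrow> 'b bip_monoid \<Rightarrow> 'a set \<Rightarrow> bool" where
  "extension_via Q' Q S \<longleftrightarrow>
     bipartite_monoid Q' \<and> reduced Q' \<and> bipartite_monoid Q \<and> reduced Q \<and>
     submonoid S Q' \<and> reduction (sub_bm Q' S) \<cong>\<^sub>b\<^sub>m Q"

definition extension :: "'a bip_monoid \<Rightarrow> 'b bip_monoid \<Rightarrow> bool" where
  "extension Q' Q \<longleftrightarrow> (\<exists>S. extension_via Q' Q S)"

text \<open>\<open>(\<lambda>T. submonoid T Q') hull X\<close> is the submonoid generated by \<open>X\<close>.\<close>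

definition one_stage_extension :: "'a bip_monoid \<Rightarrow> 'b bip_monoid \<Rightarrow> bool" where
  "one_stage_extension Q' Q \<longleftrightarrow>
     (\<exists>S. extension_via Q' Q S \<and>
        (\<exists>x\<in>carrier Q' - S. (\<lambda>T. submonoid T Q') hull (S \<union> {x}) = carrier Q'))"

section \<open>Misere quotients\<close>

definition games_bm :: "game set \<Rightarrow> game bip_monoid" where
  "games_bm \<A> =
     \<lparr> carrier = \<A>, mult = game_sum, one = zero_game, distinguished = {G \<in> \<A>. misere_P G} \<rparr>"

definition misere_equiv :: "game set \<Rightarrow> (game \<times> game) set" where
  "misere_equiv \<A> =
     {(G, H). G \<in> \<A> \<and> H \<in> \<A> \<and>
        (\<forall>X\<in>\<A>. misere_P (game_sum G X) \<longleftrightarrow> misere_P (game_sum H X))}"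

definition misere_quotient_of :: "game set \<Rightarrow> game set bip_monoid" where
  "misere_quotient_of \<A> = quotient_bm (games_bm \<A>) (misere_equiv \<A>)"

definition is_misere_quotient :: "'a bip_monoid \<Rightarrow> bool" where
  "is_misere_quotient Q \<longleftrightarrow>
     bipartite_monoid Q \<and> (\<exists>\<A>. closed_games \<A> \<and> Q \<cong>\<^sub>b\<^sub>m misere_quotient_of \<A>)"

section \<open>The monoids \<open>\<T>\<^sub>k\<close> and \<open>\<R>\<close>\<close>

text \<open>One multiplication serves \<open>\<T>\<^sub>k\<close> and \<open>\<R>\<close> for all \<open>k\<close>; only the carriers differ.
  \<open>E1\<close>, \<open>Ea\<close>, \<open>Et\<close>, \<open>Eat\<close>, \<open>Ez i\<close> stand for \<open>1\<close>, \<open>a\<close>, \<open>t\<close>, \<open>at\<close>, \<open>z\<^sub>i\<close>.\<close>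

datatype elem = E1 | Ea | Et | Eat | Ez nat

fun elem_mult :: "elem \<Rightarrow> elem \<Rightarrow> elem" where
  "elem_mult E1 y = y"
| "elem_mult x E1 = x"
| "elem_mult Ea Ea = E1"
| "elem_mult Ea Et = Eat"
| "elem_mult Et Ea = Eat"
| "elem_mult Ea Eat = Et"
| "elem_mult Eat Ea = Et"
| "elem_mult Et Et = Ez 0"
| "elem_mult Et Eat = Ez 1"
| "elem_mult Eat Et = Ez 1"
| "elem_mult Eat Eat = Ez 0"
| "elem_mult Ea (Ez i) = Ez (i XOR 1)"
| "elem_mult (Ez i) Ea = Ez (i XOR 1)"
| "elem_mult Et (Ez i) = Ez i"
| "elem_mult (Ez i) Et = Ez i"
| "elem_mult Eat (Ez i) = Ez (i XOR 1)"
| "elem_mult (Ez i) Eat = Ez (i XOR 1)"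
| "elem_mult (Ez i) (Ez j) = Ez (i XOR j)"

definition T_bm :: "nat \<Rightarrow> elem bip_monoid" where
  "T_bm k =
     \<lparr> carrier = {E1, Ea} \<union> Ez ` {..<2 ^ k}, mult = elem_mult, one = E1,
       distinguished = {Ea, Ez 0} \<rparr>"

text \<open>\<open>R_bm k\<close> is the monoid usually written \<open>\<R>\<close> with its cardinality \<open>2^k + 4\<close> as index.\<close>

definition R_bm :: "nat \<Rightarrow> elem bip_monoid" where
  "R_bm k = (T_bm k) \<lparr> carrier := carrier (T_bm k) \<union> {Et, Eat} \<rparr>"

end

theory Submission
  imports Defs
begin

text \<open>Let \<open>\<Phi>\<close> be the quotient map from games to \<open>Q\<close> and \<open>\<rho>\<close> the reduction map from the submonoid \<open>S\<close>
  to \<open>R_bm n\<close>. Both distinguished subsets have two elements and \<open>\<rho>\<close> preserves and reflects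
  distinguishedness, so \<open>\<P> = {a, z} \<subseteq> S\<close> where \<open>a\<close>, \<open>z\<close> are the only preimages of \<open>a\<close>, \<open>z\<^sub>0\<close>. Hence
  \<open>z\<close> is idempotent, and \<open>a = \<Phi> star\<close> is an involution. A move never preserves the component
  \<open>\<Phi> G \<otimes> z\<close>. Applied to games all of whose options avoid a given set of values, this shows that
  \<open>\<one>\<close> and \<open>a\<close> are the only units, that the kernel \<open>{x \<otimes> z | x}\<close> is an elementary abelian 2-group,
  and that nonunits with equal kernel component multiply to \<open>z\<close>. As \<open>Q\<close> is reduced, it therefore
  consists of the kernel and four further elements \<open>\<one>\<close>, \<open>a\<close>, \<open>t\<close>, \<open>a \<otimes> t\<close>, which all lie in \<open>S\<close>, so the
  one additional generator lies in the kernel and doubles it.\<close>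

section \<open>Sums of games and their outcomes\<close>

lemma game_sum_zero: "game_sum zero_game G = G"
proof (induction G rule: wf_induct_rule[OF wf_option_rel])
  case (1 G)
  have "(\<lambda>G'. game_sum zero_game G') |`| opts G = (\<lambda>G'. G') |`| opts G"
    by (rule fimage_fundef_cong) (use 1 in \<open>auto simp: option_rel_def\<close>)
  then show ?case
    by (subst game_sum.simps) (simp add: zero_game_def)
qed

lemma opts_game_sum:
  "fset (opts (game_sum G H)) =
     (\<lambda>G'. game_sum G' H) ` fset (opts G) \<union> (\<lambda>H'. game_sum G H') ` fset (opts H)"
  by (subst game_sum.simps) simp

lemma game_eqI: "fset (opts G) = fset (opts H) \<Longrightarrow> G = H"
  by (cases G; cases H) (simp add: fset_inject)

lemma game_sum_commute: "game_sum G H = game_sum H G"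
proof (induction G arbitrary: H rule: wf_induct_rule[OF wf_option_rel])
  case outer: (1 G)
  show ?case
  proof (induction H rule: wf_induct_rule[OF wf_option_rel])
    case (1 H)
    have "(\<lambda>G'. game_sum G' H) ` fset (opts G) = (\<lambda>G'. game_sum H G') ` fset (opts G)"
      by (rule image_cong) (use outer in \<open>auto simp: option_rel_def\<close>)
    moreover have "(\<lambda>H'. game_sum G H') ` fset (opts H) = (\<lambda>H'. game_sum H' G) ` fset (opts H)"
      by (rule image_cong) (use 1 in \<open>auto simp: option_rel_def\<close>)
    ultimately show ?case
      by (intro game_eqI) (auto simp: opts_game_sum)
  qed
qed

lemma game_sum_assoc: "game_sum (game_sum G H) K = game_sum G (game_sum H K)"
proof (induction G arbitrary: H K rule: wf_induct_rule[OF wf_option_rel])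
  case G: (1 G)
  show ?case
  proof (induction H arbitrary: K rule: wf_induct_rule[OF wf_option_rel])
    case H: (1 H)
    show ?case
    proof (induction K rule: wf_induct_rule[OF wf_option_rel])
      case K: (1 K)
      have 1: "(\<lambda>G'. game_sum (game_sum G' H) K) ` fset (opts G)
          = (\<lambda>G'. game_sum G' (game_sum H K)) ` fset (opts G)"
        by (rule image_cong) (use G in \<open>auto simp: option_rel_def\<close>)
      have 2: "(\<lambda>H'. game_sum (game_sum G H') K) ` fset (opts H)
          = (\<lambda>H'. game_sum G (game_sum H' K)) ` fset (opts H)"
        by (rule image_cong) (use H in \<open>auto simp: option_rel_def\<close>)
      have 3: "(\<lambda>K'. game_sum (game_sum G H) K') ` fset (opts K)
          = (\<lambda>K'. game_sum G (game_sum H K')) ` fset (opts K)"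
        by (rule image_cong) (use K in \<open>auto simp: option_rel_def\<close>)
      show ?case
        by (rule game_eqI) (simp add: opts_game_sum image_Un image_image 1 2 3 Un_assoc)
    qed
  qed
qed

section \<open>Outcomes, and the nim-heap \<open>star\<close> of size one\<close>

lemma misere_P_iff: "misere_P G \<longleftrightarrow> G \<noteq> zero_game \<and> (\<forall>G'\<in>fset (opts G). \<not> misere_P G')"
  by (subst misere_P.simps) simp

lemma opts_empty_iff: "fset (opts G) = {} \<longleftrightarrow> G = zero_game"
  using game_eqI[of G zero_game] by (auto simp: zero_game_def)

lemma game_sum_eq_zero_iff: "game_sum G H = zero_game \<longleftrightarrow> G = zero_game \<and> H = zero_game"
  unfolding opts_empty_iff[symmetric] opts_game_sum by simp

definition star :: game where
  "star = Game {|zero_game|}"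

lemma opts_star: "fset (opts star) = {zero_game}"
  by (simp add: star_def)

lemma not_misere_P_zero: "\<not> misere_P zero_game"
  using misere_P_iff by blast

lemma misere_P_star: "misere_P star"
  using opts_empty_iff[of star] by (subst misere_P_iff) (simp add: opts_star not_misere_P_zero)

text \<open>Apart from the sums with options of \<open>G\<close>, covered by induction, the only
  option is \<open>game_sum star G\<close>. It has the option \<open>G\<close>, so it is not a
  P-position when \<open>G\<close> is one. If \<open>G = zero_game\<close>, which is an N-position
  without options, it is the P-position \<open>star\<close>. This will make the value of
  \<open>star\<close> an involution.\<close>

lemma misere_P_add_star_star:
  "misere_P (game_sum (game_sum star star) G) \<longleftrightarrow> misere_P G"
proof (induction G rule: wf_induct_rule[OF wf_option_rel])
  case (1 G)
  have star_star: "fset (opts (game_sum star star)) = {star}"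
    by (auto simp: opts_game_sum opts_star game_sum_zero game_sum_commute[of star zero_game])
  have opts: "fset (opts (game_sum (game_sum star star) G))
      = insert (game_sum star G) (game_sum (game_sum star star) ` fset (opts G))"
    by (simp add: opts_game_sum[of _ G] star_star)
  have nonzero: "game_sum (game_sum star star) G \<noteq> zero_game"
    using opts_empty_iff[of "game_sum (game_sum star star) G"] by (simp add: opts)
  have IH: "misere_P (game_sum (game_sum star star) G') \<longleftrightarrow> misere_P G'" if "G' \<in> fset (opts G)" for G'
    using 1 that by (simp add: option_rel_def)
  have option: "G \<in> fset (opts (game_sum star G))"
    by (simp add: opts_game_sum opts_star game_sum_zero)
  have *: "\<not> misere_P (game_sum star G)" if "misere_P G"
    using that option misere_P_iff[of "game_sum star G"] by blast
  have unfold: "misere_P (game_sum (game_sum star star) G) \<longleftrightarrow>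
      \<not> misere_P (game_sum star G) \<and> (\<forall>G'\<in>fset (opts G). \<not> misere_P G')"
    using IH nonzero by (subst misere_P_iff) (simp add: opts)
  show ?case
  proof (cases "G = zero_game")
    case True
    then have "game_sum star G = star"
      by (simp add: game_sum_commute[of star] game_sum_zero)
    then show ?thesis
      using unfold misere_P_star True not_misere_P_zero by simp
  next
    case False
    then show ?thesis
      using * unfold misere_P_iff[of G] by blast
  qed
qed

text \<open>A nonzero game of \<open>A\<close> that is minimal for \<open>option_rel\<close> has
  \<open>zero_game\<close> as its only option.\<close>

lemma star_in_closed_games:
  assumes "closed_games A" "G \<in> A" "G \<noteq> zero_game"
  shows "star \<in> A"
proof -
  obtain H where H: "H \<in> A - {zero_game}" and min: "\<And>H'. (H', H) \<in> option_rel \<Longrightarrow> H' \<notin> A - {zero_game}"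
    using wfE_min[OF wf_option_rel, of G "A - {zero_game}"] assms by blast
  have "fset (opts H) \<subseteq> {zero_game}"
    using min assms H by (auto simp: closed_games_def option_rel_def)
  then have "H = star"
    using H opts_empty_iff[of H] by (intro game_eqI) (auto simp: opts_star)
  then show ?thesis
    using H by simp
qed

section \<open>Homomorphisms of bipartite monoids\<close>

text \<open>Membership in \<open>hom\<close> does not force the identity to be preserved, hence the
  separate conjunct. The equivalence makes the map reflect distinguished elements as well as
  preserve them.\<close>

definition bm_hom :: "('a, 'c) bip_monoid_scheme \<Rightarrow> ('b, 'd) bip_monoid_scheme \<Rightarrow> ('a \<Rightarrow> 'b) set" where
  "bm_hom M N = {f \<in> hom M N. f \<one>\<^bsub>M\<^esub> = \<one>\<^bsub>N\<^esub> \<and>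
     (\<forall>x\<in>carrier M. f x \<in> \<P>\<^bsub>N\<^esub> \<longleftrightarrow> x \<in> \<P>\<^bsub>M\<^esub>)}"

text \<open>Closure is assumed in place of the monoid laws, so that the lemma applies to
  \<open>R_bm (n + 1)\<close>, for which only closure is established.\<close>

lemma bm_iso_sym:
  assumes "M \<cong>\<^sub>b\<^sub>m N"
    and closed: "\<And>x y. \<lbrakk>x \<in> carrier M; y \<in> carrier M\<rbrakk> \<Longrightarrow> x \<otimes>\<^bsub>M\<^esub> y \<in> carrier M"
    and P: "\<P>\<^bsub>M\<^esub> \<subseteq> carrier M"
  shows "N \<cong>\<^sub>b\<^sub>m M"
proof -
  obtain h where h: "h \<in> hom M N" "bij_betw h (carrier M) (carrier N)" "h ` \<P>\<^bsub>M\<^esub> = \<P>\<^bsub>N\<^esub>"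
    using assms(1) by (auto simp: bm_iso_def iso_def)
  define g where "g = inv_into (carrier M) h"
  have bij: "bij_betw g (carrier N) (carrier M)"
    using bij_betw_inv_into[OF h(2)] by (simp add: g_def)
  have hg: "h (g x) = x" if "x \<in> carrier N" for x
    using bij_betw_inv_into_right[OF h(2) that] by (simp add: g_def)
  have gh: "g (h x) = x" if "x \<in> carrier M" for x
    using bij_betw_inv_into_left[OF h(2) that] by (simp add: g_def)
  have "g \<in> hom N M"
  proof (rule homI)
    fix x y assume xy: "x \<in> carrier N" "y \<in> carrier N"
    then show gx: "g x \<in> carrier M"
      using bij bij_betwE by blast
    have gy: "g y \<in> carrier M"
      using xy bij bij_betwE by blast
    then have "h (g x \<otimes>\<^bsub>M\<^esub> g y) = x \<otimes>\<^bsub>N\<^esub> y"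
      using h(1) gx gy xy by (simp add: hom_mult hg)
    then show "g (x \<otimes>\<^bsub>N\<^esub> y) = g x \<otimes>\<^bsub>M\<^esub> g y"
      using gh[of "g x \<otimes>\<^bsub>M\<^esub> g y"] gx gy closed by simp
  qed
  moreover have "g ` \<P>\<^bsub>N\<^esub> = \<P>\<^bsub>M\<^esub>"
    using inv_into_image_cancel[OF bij_betw_imp_inj_on[OF h(2)] P] by (simp add: g_def h(3))
  ultimately show ?thesis
    using bij by (auto simp: bm_iso_def iso_def)
qed

lemma surj_hom_one:
  assumes "f \<in> hom M N" "f ` carrier M = carrier N" "monoid M" "monoid N"
  shows "f \<one>\<^bsub>M\<^esub> = \<one>\<^bsub>N\<^esub>"
proof -
  interpret M: monoid M by fact
  interpret N: monoid N by fact
  obtain e where e: "e \<in> carrier M" "f e = \<one>\<^bsub>N\<^esub>"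
    using assms(2) N.one_closed by (metis imageE)
  have "f \<one>\<^bsub>M\<^esub> \<in> carrier N"
    using assms(2) by blast
  then have "f \<one>\<^bsub>M\<^esub> = f \<one>\<^bsub>M\<^esub> \<otimes>\<^bsub>N\<^esub> f e"
    using e by simp
  also have "\<dots> = f (\<one>\<^bsub>M\<^esub> \<otimes>\<^bsub>M\<^esub> e)"
    using hom_mult[OF assms(1) M.one_closed e(1)] by simp
  finally show ?thesis
    using e by simp
qed

text \<open>The map is the class projection followed by the isomorphism. It reflects distinguished
  elements because the distinguished set is a union of classes of \<open>r\<close>.\<close>

lemma bm_hom_of_quotient_iso:
  assumes M: "comm_monoid M" and N: "monoid N"
    and equiv: "equiv (carrier M) r"
    and cong: "\<And>x y w. \<lbrakk>(x, y) \<in> r; w \<in> carrier M\<rbrakk> \<Longrightarrow> (x \<otimes>\<^bsub>M\<^esub> w, y \<otimes>\<^bsub>M\<^esub> w) \<in> r"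
    and saturated: "\<And>x y. \<lbrakk>(x, y) \<in> r; x \<in> \<P>\<^bsub>M\<^esub>\<rbrakk> \<Longrightarrow> y \<in> \<P>\<^bsub>M\<^esub>"
    and P: "\<P>\<^bsub>M\<^esub> \<subseteq> carrier M"
    and iso: "quotient_bm M r \<cong>\<^sub>b\<^sub>m N"
  obtains f where "f \<in> bm_hom M N" "f ` carrier M = carrier N"
proof -
  interpret M: comm_monoid M by fact
  obtain h where h: "h \<in> iso (quotient_bm M r) N" "h ` \<P>\<^bsub>quotient_bm M r\<^esub> = \<P>\<^bsub>N\<^esub>"
    using iso by (auto simp: bm_iso_def)
  define f where "f = (\<lambda>x. h (r `` {x}))"
  have carrier_q: "carrier (quotient_bm M r) = (\<lambda>x. r `` {x}) ` carrier M"
    by (auto simp: quotient_bm_def quotient_def)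
  have mem: "x \<in> carrier M" "y \<in> carrier M" if "(x, y) \<in> r" for x y
    using equiv_type[OF equiv] that by auto
  have cong2: "(x \<otimes>\<^bsub>M\<^esub> y, x' \<otimes>\<^bsub>M\<^esub> y') \<in> r" if "(x, x') \<in> r" "(y, y') \<in> r" for x x' y y'
    using cong[OF that(1), of y] cong[OF that(2), of x'] mem[OF that(1)] mem[OF that(2)]
      equiv by (auto simp: M.m_comm equiv_def elim: transE)
  have mult_q: "r `` {x} \<otimes>\<^bsub>quotient_bm M r\<^esub> r `` {y} = r `` {x \<otimes>\<^bsub>M\<^esub> y}"
    if "x \<in> carrier M" "y \<in> carrier M" for x y
  proof -
    have "r `` {x' \<otimes>\<^bsub>M\<^esub> y'} = r `` {x \<otimes>\<^bsub>M\<^esub> y}" if "x' \<in> r `` {x}" "y' \<in> r `` {y}" for x' y'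
      using cong2[of x x' y y'] that equiv_class_eq[OF equiv] by blast
    then have "(\<Union>x'\<in>r `` {x}. \<Union>y'\<in>r `` {y}. r `` {x' \<otimes>\<^bsub>M\<^esub> y'})
        = (\<Union>x'\<in>r `` {x}. \<Union>y'\<in>r `` {y}. r `` {x \<otimes>\<^bsub>M\<^esub> y})"
      by (intro SUP_cong refl)
    also have "\<dots> = r `` {x \<otimes>\<^bsub>M\<^esub> y}"
      using that equiv_class_self[OF equiv] by blast
    finally show ?thesis
      by (simp add: quotient_bm_def)
  qed
  have hom: "f \<in> hom M N"
  proof (rule homI)
    fix x y assume xy: "x \<in> carrier M" "y \<in> carrier M"
    then show "f x \<in> carrier N"
      using h(1) by (auto simp: f_def carrier_q iso_def hom_def Pi_def)
    show "f (x \<otimes>\<^bsub>M\<^esub> y) = f x \<otimes>\<^bsub>N\<^esub> f y"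
      using xy h(1) by (auto simp: f_def carrier_q iso_def hom_def simp flip: mult_q)
  qed
  moreover have surj: "f ` carrier M = carrier N"
    using h(1) by (auto simp: f_def carrier_q iso_def bij_betw_def image_image)
  moreover have "f x \<in> \<P>\<^bsub>N\<^esub> \<longleftrightarrow> x \<in> \<P>\<^bsub>M\<^esub>" if x: "x \<in> carrier M" for x
  proof
    assume "x \<in> \<P>\<^bsub>M\<^esub>"
    then show "f x \<in> \<P>\<^bsub>N\<^esub>"
      using h(2) by (auto simp: f_def quotient_bm_def)
  next
    assume "f x \<in> \<P>\<^bsub>N\<^esub>"
    then obtain p where p: "p \<in> \<P>\<^bsub>M\<^esub>" "h (r `` {x}) = h (r `` {p})"
      using h(2) by (auto simp: f_def quotient_bm_def)
    then have "r `` {x} = r `` {p}"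
      using h(1) x P by (auto simp: iso_def bij_betw_def carrier_q dest: inj_onD)
    then have "(p, x) \<in> r"
      using equiv x by (metis Image_singleton_iff equiv_class_self)
    then show "x \<in> \<P>\<^bsub>M\<^esub>"
      using saturated p by blast
  qed
  ultimately show thesis
    using surj_hom_one[OF hom surj M.monoid_axioms N] by (intro that) (auto simp: bm_hom_def)
qed

lemma reduction_projection:
  assumes "comm_monoid M" "monoid N" "\<P>\<^bsub>M\<^esub> \<subseteq> carrier M" "reduction M \<cong>\<^sub>b\<^sub>m N"
  obtains f where "f \<in> bm_hom M N" "f ` carrier M = carrier N"
proof (rule bm_hom_of_quotient_iso[of M N "indist M"])
  interpret comm_monoid M by fact
  note project = that
  show "equiv (carrier M) (indist M)"
    by (auto simp: equiv_def indist_def refl_on_def sym_def trans_def)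
  show "(x \<otimes>\<^bsub>M\<^esub> w, y \<otimes>\<^bsub>M\<^esub> w) \<in> indist M" if "(x, y) \<in> indist M" "w \<in> carrier M" for x y w
    using that by (auto simp: indist_def m_assoc)
  \<comment> \<open>The test element \<open>w = \<one>\<close> gives saturation.\<close>
  show "y \<in> \<P>\<^bsub>M\<^esub>" if "(x, y) \<in> indist M" "x \<in> \<P>\<^bsub>M\<^esub>" for x y
    using that by (auto simp: indist_def dest!: bspec[of _ _ "\<one>\<^bsub>M\<^esub>"])
  show thesis if "f \<in> bm_hom M N" "f ` carrier M = carrier N" for f
    using that by (rule project)
qed (use assms(1-4) in \<open>simp_all add: reduction_def\<close>)

lemma comm_monoid_games_bm:
  assumes "closed_games A"
  shows "comm_monoid (games_bm A)"
  using assms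
  by (intro comm_monoidI)
    (auto simp: games_bm_def closed_games_def game_sum_zero game_sum_assoc intro: game_sum_commute)

text \<open>On \<open>games_bm A\<close> the relation \<open>misere_equiv A\<close> is
  indistinguishability, so a misere quotient is itself a reduction.\<close>

lemma misere_quotient_projection:
  assumes "closed_games A" "monoid Q" "misere_quotient_of A \<cong>\<^sub>b\<^sub>m Q"
  obtains f where "f \<in> bm_hom (games_bm A) Q" "f ` A = carrier Q"
proof -
  note project = that
  have equiv: "misere_equiv A = indist (games_bm A)"
    using assms(1) by (auto simp: misere_equiv_def indist_def games_bm_def closed_games_def)
  show thesis
  proof (rule reduction_projection[of "games_bm A" Q])
    show "comm_monoid (games_bm A)" "monoid Q" "\<P>\<^bsub>games_bm A\<^esub> \<subseteq> carrier (games_bm A)"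
      using assms comm_monoid_games_bm by (auto simp: games_bm_def)
    show "reduction (games_bm A) \<cong>\<^sub>b\<^sub>m Q"
      using assms(3) by (simp add: equiv reduction_def misere_quotient_of_def)
    show thesis if f: "f \<in> bm_hom (games_bm A) Q" "f ` carrier (games_bm A) = carrier Q" for f
      by (rule project[OF f(1)]) (use f(2) in \<open>simp add: games_bm_def\<close>)
  qed
qed

section \<open>Misere quotients with two distinguished elements\<close>

text \<open>The homomorphism \<open>\<Phi>\<close> values games in \<open>Q\<close>; \<open>a\<close> is the value of \<open>star\<close>, and \<open>z\<close> the identity of
  the kernel \<open>{x \<otimes> z | x}\<close>.\<close>

locale two_point_misere_quotient = comm_monoid Q for Q :: "'a bip_monoid" (structure) +
  fixes A \<Phi> a z
  assumes closed_A: "closed_games A"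
    and \<Phi>_hom: "\<Phi> \<in> bm_hom (games_bm A) Q"
    and \<Phi>_surj: "\<Phi> ` A = carrier Q"
    and reduced_Q: "reduced Q"
    and P_eq: "\<P> = {a, z}"
    and a_closed [simp]: "a \<in> carrier Q"
    and z_closed [simp]: "z \<in> carrier Q"
    and a_a [simp]: "a \<otimes> a = \<one>"
    and z_z [simp]: "z \<otimes> z = z"
    and z_ne_one [simp]: "z \<noteq> \<one>"
    and az_ne_z [simp]: "a \<otimes> z \<noteq> z"
begin

lemma a_a_left [simp]: "x \<in> carrier Q \<Longrightarrow> a \<otimes> (a \<otimes> x) = x"
  by (simp flip: m_assoc)

lemma z_z_left [simp]: "x \<in> carrier Q \<Longrightarrow> z \<otimes> (z \<otimes> x) = z \<otimes> x"
  by (simp flip: m_assoc)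

lemma a_ne_one [simp]: "a \<noteq> \<one>"
  using az_ne_z l_one[OF z_closed] by metis

lemma a_ne_z [simp]: "a \<noteq> z"
  using a_a z_z z_ne_one by metis

lemma one_not_P: "\<one> \<notin> \<P>"
  using a_ne_one z_ne_one by (simp add: P_eq eq_commute)

lemma \<Phi>_closed [simp]: "G \<in> A \<Longrightarrow> \<Phi> G \<in> carrier Q"
  using \<Phi>_surj by blast

lemma \<Phi>_zero [simp]: "\<Phi> zero_game = \<one>"
  using \<Phi>_hom by (simp add: bm_hom_def games_bm_def)

lemma \<Phi>_sum: "\<lbrakk>G \<in> A; H \<in> A\<rbrakk> \<Longrightarrow> \<Phi> (game_sum G H) = \<Phi> G \<otimes> \<Phi> H"
  using \<Phi>_hom by (simp add: bm_hom_def games_bm_def hom_def)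

lemma \<Phi>_P: "G \<in> A \<Longrightarrow> \<Phi> G \<in> \<P> \<longleftrightarrow> misere_P G"
  using \<Phi>_hom by (simp add: bm_hom_def games_bm_def)

lemma sum_closed: "\<lbrakk>G \<in> A; H \<in> A\<rbrakk> \<Longrightarrow> game_sum G H \<in> A"
  using closed_A by (simp add: closed_games_def)

lemma opts_closed: "\<lbrakk>G \<in> A; G' \<in> fset (opts G)\<rbrakk> \<Longrightarrow> G' \<in> A"
  using closed_A by (auto simp: closed_games_def)

section \<open>Moves and outcomes expressed through values\<close>

lemma obtain_game:
  assumes "x \<in> carrier Q"
  obtains G where "G \<in> A" "\<Phi> G = x"
proof -
  have "x \<in> \<Phi> ` A"
    using assms \<Phi>_surj by simp
  then show thesis
    using that by (elim imageE) simp
qed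

text \<open>Serves as the induction principle for values: all options of the chosen game leave
  \<open>X\<close>, so a move whose value is shown to lie in \<open>X\<close> is a
  contradiction.\<close>

lemma obtain_minimal_game:
  assumes "x \<in> X" "x \<in> carrier Q"
  obtains G where "G \<in> A" "\<Phi> G \<in> X" "\<And>G'. G' \<in> fset (opts G) \<Longrightarrow> \<Phi> G' \<notin> X"
proof -
  obtain H where "H \<in> A" "\<Phi> H = x"
    using assms(2) by (rule obtain_game)
  then have "H \<in> {G \<in> A. \<Phi> G \<in> X}"
    using assms(1) by simp
  then obtain G where "G \<in> {G \<in> A. \<Phi> G \<in> X}"
      and "\<And>G'. (G', G) \<in> option_rel \<Longrightarrow> G' \<notin> {G \<in> A. \<Phi> G \<in> X}"
    by (rule wfE_min[OF wf_option_rel]) blast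
  then show thesis
    using opts_closed by (intro that[of G]) (auto simp: option_rel_def)
qed

text \<open>With \<open>w\<close> realized by a game \<open>X\<close>, the move from
  \<open>G\<close> to \<open>G'\<close> is also a move from the P-position
  \<open>game_sum G X\<close>.\<close>

lemma option_not_P:
  assumes "G \<in> A" "G' \<in> fset (opts G)" "w \<in> carrier Q" "\<Phi> G \<otimes> w \<in> \<P>"
  shows "\<Phi> G' \<otimes> w \<notin> \<P>"
proof -
  obtain X where X: "X \<in> A" "\<Phi> X = w"
    using assms(3) by (rule obtain_game)
  then have "misere_P (game_sum G X)"
    using assms \<Phi>_P[of "game_sum G X"] by (simp add: \<Phi>_sum sum_closed)
  moreover have "game_sum G' X \<in> fset (opts (game_sum G X))"
    using assms(2) by (simp add: opts_game_sum)
  ultimately have "\<not> misere_P (game_sum G' X)"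
    using misere_P_iff by blast
  then show ?thesis
    using X assms opts_closed \<Phi>_P[of "game_sum G' X"] by (simp add: \<Phi>_sum sum_closed)
qed

text \<open>The hypothesis \<open>G \<noteq> zero_game\<close> rules out the zero sum, which has no
  options and is nevertheless an N-position.\<close>

lemma sum_in_P:
  assumes "G \<in> A" "H \<in> A" "G \<noteq> zero_game"
    and "\<And>G'. G' \<in> fset (opts G) \<Longrightarrow> \<Phi> G' \<otimes> \<Phi> H \<notin> \<P>"
    and "\<And>H'. H' \<in> fset (opts H) \<Longrightarrow> \<Phi> G \<otimes> \<Phi> H' \<notin> \<P>"
  shows "\<Phi> G \<otimes> \<Phi> H \<in> \<P>"
proof -
  have "\<not> misere_P K" if K: "K \<in> fset (opts (game_sum G H))" for K
  proof -
    have "K \<in> A"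
      using K opts_closed sum_closed assms(1,2) by blast
    moreover have "\<Phi> K \<notin> \<P>"
      using K assms opts_closed by (auto simp: opts_game_sum \<Phi>_sum)
    ultimately show ?thesis
      by (simp add: \<Phi>_P)
  qed
  then have "misere_P (game_sum G H)"
    using assms(3) by (subst misere_P_iff) (simp add: game_sum_eq_zero_iff)
  then show ?thesis
    using assms(1,2) \<Phi>_P[of "game_sum G H"] by (simp add: \<Phi>_sum sum_closed)
qed

section \<open>The kernel \<open>{x \<otimes> z | x}\<close> as a group with identity
  \<open>z\<close>\<close>

lemma z_mult_ne_a:
  assumes "y \<in> carrier Q"
  shows "z \<otimes> y \<noteq> a"
proof
  assume eq: "z \<otimes> y = a"
  \<comment> \<open>Since \<open>a\<close> is invertible, it cancels and \<open>z\<close> becomes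
    the identity.\<close>
  then have "z \<otimes> a = a"
    using z_z_left[OF assms] by simp
  then have "z \<otimes> (a \<otimes> a) = a \<otimes> a"
    by (simp flip: m_assoc del: a_a)
  then show False
    by simp
qed

text \<open>If no multiple of \<open>x\<close> were distinguished, no option of
  \<open>game_sum G G\<close> would be a P-position for a nonzero \<open>G\<close> of value
  \<open>x\<close>, so \<open>x \<otimes> x\<close> would be distinguished after all.\<close>

lemma ex_mult_in_P:
  assumes "x \<in> carrier Q"
  shows "\<exists>y\<in>carrier Q. x \<otimes> y \<in> \<P>"
proof (cases "x = \<one>")
  case True
  then show ?thesis
    by (intro bexI[of _ a]) (simp_all add: P_eq)
next
  case False
  obtain G where G: "G \<in> A" "\<Phi> G = x"
    using assms by (rule obtain_game)
  then have "G \<noteq> zero_game"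
    using False by auto
  show ?thesis
  proof (rule ccontr)
    assume none: "\<not> ?thesis"
    have "\<Phi> G \<otimes> \<Phi> G \<in> \<P>"
      using G \<open>G \<noteq> zero_game\<close> none opts_closed assms
      by (intro sum_in_P) (auto simp: m_comm[of "\<Phi> _" x])
    then show False
      using none G assms by auto
  qed
qed

text \<open>Some multiple of \<open>x \<otimes> z\<close> is distinguished, and
  \<open>z_mult_ne_a\<close> leaves only the value \<open>z\<close>. This supplies inverses in the
  kernel.\<close>

lemma kernel_inverse:
  assumes "x \<in> carrier Q"
  obtains y where "y \<in> carrier Q" "x \<otimes> (z \<otimes> y) = z"
proof -
  obtain y where "y \<in> carrier Q" "(x \<otimes> z) \<otimes> y \<in> \<P>"
    using ex_mult_in_P[of "x \<otimes> z"] assms by auto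
  moreover have "x \<otimes> (z \<otimes> y) \<noteq> a"
    using z_mult_ne_a[of "x \<otimes> y"] assms calculation(1) by (simp add: m_lcomm)
  ultimately show thesis
    using that assms by (auto simp: P_eq m_assoc)
qed

text \<open>Moving changes the kernel component, as a move changes the Grundy value in normal play.\<close>

lemma option_mult_z_ne:
  assumes "G \<in> A" "G' \<in> fset (opts G)"
  shows "\<Phi> G' \<otimes> z \<noteq> \<Phi> G \<otimes> z"
proof
  assume eq: "\<Phi> G' \<otimes> z = \<Phi> G \<otimes> z"
  obtain y where y: "y \<in> carrier Q" "\<Phi> G \<otimes> (z \<otimes> y) = z"
    using kernel_inverse[of "\<Phi> G"] assms by auto
  moreover have "\<Phi> G' \<otimes> (z \<otimes> y) = z"
    using y eq assms opts_closed by (metis \<Phi>_closed m_assoc z_closed)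
  ultimately show False
    using option_not_P[OF assms, of "z \<otimes> y"] by (simp add: P_eq)
qed

text \<open>Choose \<open>G\<close> and \<open>H\<close> with values in \<open>{u, a \<otimes> u}\<close> and \<open>{v, a \<otimes> v}\<close> so that no option stays in
  these sets, and let \<open>K = G + H\<close>. Then \<open>K + K\<close> has value \<open>\<one>\<close>, so one of its options \<open>K' + K\<close> is a
  P-position, which forces an excluded option of \<open>G\<close> or \<open>H\<close>.\<close>

lemma unit_cases:
  assumes uv: "u \<in> carrier Q" "v \<in> carrier Q" "u \<otimes> v = \<one>"
  shows "u = \<one> \<or> u = a"
proof (rule ccontr)
  assume nontrivial: "\<not> ?thesis"
  obtain G where G: "G \<in> A" "\<Phi> G \<in> {u, a \<otimes> u}"
      and minG: "\<And>G'. G' \<in> fset (opts G) \<Longrightarrow> \<Phi> G' \<notin> {u, a \<otimes> u}"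
    using obtain_minimal_game[of u "{u, a \<otimes> u}"] uv by blast
  obtain H where H: "H \<in> A" "\<Phi> H \<in> {v, a \<otimes> v}"
      and minH: "\<And>H'. H' \<in> fset (opts H) \<Longrightarrow> \<Phi> H' \<notin> {v, a \<otimes> v}"
    using obtain_minimal_game[of v "{v, a \<otimes> v}"] uv by blast
  define K where "K = game_sum G H"
  define c where "c = \<Phi> K"
  have K: "K \<in> A" "c = \<Phi> G \<otimes> \<Phi> H"
    using G H by (simp_all add: K_def c_def \<Phi>_sum sum_closed)
  have c: "c \<in> {\<one>, a}"
    using G H uv by (auto simp: K m_ac)
  then have c_closed: "c \<in> carrier Q" and c_c: "c \<otimes> c = \<one>"
    by auto
  have au: "a \<otimes> \<Phi> G \<in> {u, a \<otimes> u}" and av: "a \<otimes> \<Phi> H \<in> {v, a \<otimes> v}"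
    using G H uv by auto
  \<comment> \<open>If \<open>G\<close> were zero, \<open>\<one>\<close> would be \<open>u\<close>
    or \<open>a \<otimes> u\<close>, and either makes \<open>u\<close> trivial.\<close>
  have "u = a" if "a \<otimes> u = \<one>"
    using that a_a_left[of u] uv by simp
  then have "K \<noteq> zero_game"
    using G nontrivial by (auto simp: K_def game_sum_eq_zero_iff)
  have "\<Phi> K' \<otimes> c \<notin> \<P>" if K': "K' \<in> fset (opts K)" for K'
  proof
    assume "\<Phi> K' \<otimes> c \<in> \<P>"
    have "K' \<in> A"
      using K' K opts_closed by blast
    then have cancel: "\<Phi> K' = (\<Phi> K' \<otimes> c) \<otimes> c"
      using c_closed by (simp add: m_assoc c_c)
    \<comment> \<open>As \<open>c\<close> is its own inverse, the value \<open>z\<close> would give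
      \<open>K'\<close> the kernel component of \<open>K\<close>.\<close>
    have "\<Phi> K' \<otimes> c \<noteq> z"
    proof
      assume "\<Phi> K' \<otimes> c = z"
      then have "\<Phi> K' \<otimes> z = c \<otimes> z"
        using cancel c_closed by (metis m_assoc m_comm z_closed z_z)
      then show False
        using option_mult_z_ne[OF K(1) K'] by (simp add: c_def)
    qed
    then have "\<Phi> K' = a \<otimes> c"
      using \<open>\<Phi> K' \<otimes> c \<in> \<P>\<close> cancel by (simp add: P_eq)
    consider G' where "G' \<in> fset (opts G)" "K' = game_sum G' H"
      | H' where "H' \<in> fset (opts H)" "K' = game_sum G H'"
      using K' by (auto simp: K_def opts_game_sum)
    then show False
    proof cases
      case 1
      have G': "G' \<in> A"
        using G 1 opts_closed by blast
      have "\<Phi> G' \<otimes> \<Phi> H = a \<otimes> (\<Phi> G \<otimes> \<Phi> H)"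
        using \<open>\<Phi> K' = a \<otimes> c\<close> 1 G' H by (simp add: K \<Phi>_sum)
      \<comment> \<open>The factor \<open>\<Phi> G \<otimes> c\<close> removes
        \<open>\<Phi> H\<close>, because \<open>\<Phi> G \<otimes> \<Phi> H = c\<close> and
        \<open>c \<otimes> c = \<one>\<close>.\<close>
      then have "(\<Phi> G' \<otimes> \<Phi> H) \<otimes> (\<Phi> G \<otimes> c) = (a \<otimes> (\<Phi> G \<otimes> \<Phi> H)) \<otimes> (\<Phi> G \<otimes> c)"
        by simp
      moreover have "(\<Phi> G' \<otimes> \<Phi> H) \<otimes> (\<Phi> G \<otimes> c) = \<Phi> G' \<otimes> (c \<otimes> c)"
        using G G' H c_closed by (simp add: K(2) m_ac)
      moreover have "(a \<otimes> (\<Phi> G \<otimes> \<Phi> H)) \<otimes> (\<Phi> G \<otimes> c) = (a \<otimes> \<Phi> G) \<otimes> (c \<otimes> c)"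
        using G G' H c_closed by (simp add: K(2) m_ac)
      ultimately have "\<Phi> G' = a \<otimes> \<Phi> G"
        using G G' by (simp add: c_c)
      then show False
        using minG[OF 1(1)] au by simp
    next
      case 2
      have H': "H' \<in> A"
        using H 2 opts_closed by blast
      have "\<Phi> G \<otimes> \<Phi> H' = a \<otimes> (\<Phi> G \<otimes> \<Phi> H)"
        using \<open>\<Phi> K' = a \<otimes> c\<close> 2 H' G by (simp add: K \<Phi>_sum)
      then have "(\<Phi> G \<otimes> \<Phi> H') \<otimes> (\<Phi> H \<otimes> c) = (a \<otimes> (\<Phi> G \<otimes> \<Phi> H)) \<otimes> (\<Phi> H \<otimes> c)"
        by simp
      moreover have "(\<Phi> G \<otimes> \<Phi> H') \<otimes> (\<Phi> H \<otimes> c) = \<Phi> H' \<otimes> (c \<otimes> c)"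
        using G H' H c_closed by (simp add: K(2) m_ac)
      moreover have "(a \<otimes> (\<Phi> G \<otimes> \<Phi> H)) \<otimes> (\<Phi> H \<otimes> c) = (a \<otimes> \<Phi> H) \<otimes> (c \<otimes> c)"
        using G H' H c_closed by (simp add: K(2) m_ac)
      ultimately have "\<Phi> H' = a \<otimes> \<Phi> H"
        using H H' by (simp add: c_c)
      then show False
        using minH[OF 2(1)] av by simp
    qed
  qed
  then have "c \<otimes> c \<in> \<P>"
    using sum_in_P[OF K(1) K(1) \<open>K \<noteq> zero_game\<close>] K(1) opts_closed c_closed
    by (simp add: c_def m_comm)
  then show False
    using c_c one_not_P by simp
qed

section \<open>Products of nonunits\<close>

definition nonunits :: "'a set" where
  "nonunits = carrier Q - {\<one>, a}"

lemma nonunits_closed: "x \<in> nonunits \<Longrightarrow> x \<in> carrier Q"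
  by (simp add: nonunits_def)

text \<open>Otherwise \<open>w \<otimes> a\<close> would invert \<open>x\<close>, but by
  \<open>unit_cases\<close> only \<open>\<one>\<close> and \<open>a\<close> are invertible. Hence
  \<open>z\<close> is the only possible distinguished multiple of a nonunit.\<close>

lemma nonunit_mult_ne_a:
  assumes "x \<in> nonunits" "w \<in> carrier Q"
  shows "x \<otimes> w \<noteq> a"
proof
  assume "x \<otimes> w = a"
  then have "x \<otimes> (w \<otimes> a) = \<one>"
    using assms by (simp add: nonunits_closed flip: m_assoc)
  then show False
    using unit_cases[of x "w \<otimes> a"] assms by (auto simp: nonunits_def)
qed

lemma nonunit_mult_in_P_iff:
  "\<lbrakk>x \<in> nonunits; w \<in> carrier Q\<rbrakk> \<Longrightarrow> x \<otimes> w \<in> \<P> \<longleftrightarrow> x \<otimes> w = z"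
  using nonunit_mult_ne_a by (simp add: P_eq)

text \<open>A minimal game \<open>G\<close> is taken among those whose kernel component is that of
  \<open>g\<close> or its inverse. If its value \<open>x\<close> is a nonunit, no option of
  \<open>game_sum G G\<close> is a P-position, so \<open>x \<otimes> x = z\<close>. Thus one of the
  two mutually inverse components is its own inverse, and both agree.\<close>

lemma kernel_square:
  assumes g: "g \<in> carrier Q"
  shows "g \<otimes> (g \<otimes> z) = z"
proof -
  obtain y where y: "y \<in> carrier Q" "g \<otimes> (z \<otimes> y) = z"
    using kernel_inverse[OF g] .
  then have gy: "(g \<otimes> z) \<otimes> (y \<otimes> z) = z"
    using g by (simp add: m_ac)
  have inverse_unique: "p \<otimes> z = r \<otimes> z"
    if "p \<in> carrier Q" "q \<in> carrier Q" "r \<in> carrier Q" "p \<otimes> q = z" "(q \<otimes> z) \<otimes> (r \<otimes> z) = z" for p q r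
  proof -
    have "p \<otimes> z = p \<otimes> ((q \<otimes> z) \<otimes> (r \<otimes> z))"
      using that by simp
    also have "\<dots> = (p \<otimes> q) \<otimes> (r \<otimes> z)"
      using that(1-3) by (simp add: m_ac)
    also have "\<dots> = r \<otimes> z"
      using that(3,4) by (simp add: m_lcomm)
    finally show ?thesis .
  qed
  \<comment> \<open>Closed under kernel inverses: an option of \<open>G\<close> with component
    inverse to that of \<open>x\<close> would stay in \<open>X\<close>.\<close>
  define X where "X = {x \<in> carrier Q. x \<otimes> z = g \<otimes> z \<or> x \<otimes> z = y \<otimes> z}"
  obtain G where G: "G \<in> A" "\<Phi> G \<in> X" and min: "\<And>G'. G' \<in> fset (opts G) \<Longrightarrow> \<Phi> G' \<notin> X"
    using obtain_minimal_game[of g X] g by (auto simp: X_def)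
  define x where "x = \<Phi> G"
  have x: "x \<in> carrier Q"
    using G by (simp add: x_def)
  have xx: "(x \<otimes> z) \<otimes> (x \<otimes> z) = z"
  proof (cases "x \<in> nonunits")
    case False
    then show ?thesis
      using x by (auto simp: nonunits_def m_ac)
  next
    case True
    have "\<Phi> G' \<otimes> x \<notin> \<P>" if G': "G' \<in> fset (opts G)" for G'
    proof
      have closed: "\<Phi> G' \<in> carrier Q"
        using G' G opts_closed by simp
      assume "\<Phi> G' \<otimes> x \<in> \<P>"
      then have "\<Phi> G' \<otimes> x = z"
        using nonunit_mult_in_P_iff[OF True closed] by (simp add: m_comm x closed)
      then have inverse: "\<Phi> G' \<otimes> z = r \<otimes> z" if "r \<in> carrier Q" "(x \<otimes> z) \<otimes> (r \<otimes> z) = z" for r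
        using inverse_unique[OF closed x that(1)] that(2) by simp
      have "x \<otimes> z = g \<otimes> z \<or> x \<otimes> z = y \<otimes> z"
        using G by (simp add: X_def x_def)
      moreover have "(y \<otimes> z) \<otimes> (g \<otimes> z) = z"
        using gy g y(1) m_comm[of "g \<otimes> z" "y \<otimes> z"] by simp
      ultimately have "\<Phi> G' \<otimes> z = y \<otimes> z \<or> \<Phi> G' \<otimes> z = g \<otimes> z"
        using inverse[OF y(1)] inverse[OF g] gy by metis
      then show False
        using min[OF G'] closed by (auto simp: X_def)
    qed
    moreover have "G \<noteq> zero_game"
      using True by (auto simp: x_def nonunits_def)
    ultimately have "x \<otimes> x \<in> \<P>"
      using sum_in_P[OF G(1) G(1)] G(1) x opts_closed by (simp add: x_def m_comm)
    then have "x \<otimes> x = z"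
      using nonunit_mult_in_P_iff[OF True x] by simp
    then have "(x \<otimes> x) \<otimes> z = z"
      by simp
    then show ?thesis
      using x by (simp add: m_ac)
  qed
  have "(g \<otimes> z) \<otimes> (g \<otimes> z) = z"
  proof (cases "x \<otimes> z = g \<otimes> z")
    case False
    then have "x \<otimes> z = y \<otimes> z"
      using G by (simp add: X_def x_def)
    then have "(y \<otimes> z) \<otimes> (y \<otimes> z) = z"
      using xx by simp
    then have "g \<otimes> z = y \<otimes> z"
      using inverse_unique[of g "z \<otimes> y" y] g y by (simp add: m_comm[of z y] m_assoc)
    then show ?thesis
      using gy by simp
  qed (use xx in simp)
  then show ?thesis
    using g by (simp add: m_ac)
qed

text \<open>By \<open>kernel_square\<close> every kernel element is its own inverse, so mutually
  inverse components are equal.\<close>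

lemma mult_eq_z_imp:
  assumes "x \<in> carrier Q" "w \<in> carrier Q" "x \<otimes> w = z"
  shows "x \<otimes> z = w \<otimes> z"
proof -
  have "x \<otimes> z = x \<otimes> (w \<otimes> (w \<otimes> z))"
    using kernel_square assms by simp
  also have "\<dots> = (x \<otimes> w) \<otimes> (w \<otimes> z)"
    using assms(1,2) by (simp add: m_assoc)
  also have "\<dots> = w \<otimes> z"
    using assms by (simp add: m_lcomm)
  finally show ?thesis .
qed

text \<open>An option of \<open>game_sum G H\<close> with distinguished value would have value
  \<open>z\<close>. By \<open>mult_eq_z_imp\<close> the move in \<open>G\<close> or \<open>H\<close>
  would then keep the kernel component, contrary to \<open>option_mult_z_ne\<close>. So the sum is a
  P-position.\<close>

lemma nonunit_mult_eq_z:
  assumes x: "x \<in> nonunits" and w: "w \<in> nonunits" and eq: "x \<otimes> z = w \<otimes> z"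
  shows "x \<otimes> w = z"
proof -
  obtain G where G: "G \<in> A" "\<Phi> G = x"
    using nonunits_closed[OF x] by (rule obtain_game)
  obtain H where H: "H \<in> A" "\<Phi> H = w"
    using nonunits_closed[OF w] by (rule obtain_game)
  have "\<Phi> G' \<otimes> w \<notin> \<P>" if G': "G' \<in> fset (opts G)" for G'
  proof
    have closed: "\<Phi> G' \<in> carrier Q"
      using G' G opts_closed by simp
    assume "\<Phi> G' \<otimes> w \<in> \<P>"
    then have "\<Phi> G' \<otimes> w = z"
      using nonunit_mult_in_P_iff[OF w closed] w by (simp add: m_comm closed nonunits_closed)
    then show False
      using mult_eq_z_imp[OF closed nonunits_closed[OF w]] option_mult_z_ne[OF G(1) G'] G eq by simp
  qed
  moreover have "x \<otimes> \<Phi> H' \<notin> \<P>" if H': "H' \<in> fset (opts H)" for H'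
  proof
    have closed: "\<Phi> H' \<in> carrier Q"
      using H' H opts_closed by simp
    assume "x \<otimes> \<Phi> H' \<in> \<P>"
    then have "x \<otimes> \<Phi> H' = z"
      using nonunit_mult_in_P_iff[OF x closed] by simp
    then show False
      using mult_eq_z_imp[OF nonunits_closed[OF x] closed] option_mult_z_ne[OF H(1) H'] H eq by simp
  qed
  moreover have "G \<noteq> zero_game"
    using x G by (auto simp: nonunits_def)
  ultimately have "x \<otimes> w \<in> \<P>"
    using sum_in_P[OF G(1) H(1)] G H by simp
  then show ?thesis
    using nonunit_mult_in_P_iff x w nonunits_closed by simp
qed

text \<open>The hypotheses make \<open>x\<close> and \<open>y\<close> indistinguishable: kernel
  components settle all nonunit test elements \<open>w\<close>, and the two equivalences settle
  \<open>w = \<one>\<close> and \<open>w = a\<close>.\<close>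

lemma nonunit_eqI:
  assumes x: "x \<in> nonunits" and y: "y \<in> nonunits" and "x \<otimes> z = y \<otimes> z"
    and "x = z \<longleftrightarrow> y = z" and "x = a \<otimes> z \<longleftrightarrow> y = a \<otimes> z"
  shows "x = y"
proof -
  have imp: "y \<otimes> w = z"
    if "x \<in> nonunits" "y \<in> nonunits" "x \<otimes> z = y \<otimes> z" "x = z \<longrightarrow> y = z" "x = a \<otimes> z \<longrightarrow> y = a \<otimes> z"
      "w \<in> carrier Q" "x \<otimes> w = z" for x y w
  proof (cases "w \<in> nonunits")
    case True
    then show ?thesis
      using that mult_eq_z_imp[of x w] by (intro nonunit_mult_eq_z) (auto simp: nonunits_closed)
  next
    case False
    then consider "w = \<one>" | "w = a"
      using \<open>w \<in> carrier Q\<close> by (auto simp: nonunits_def)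
    then show ?thesis
    proof cases
      case 1
      then show ?thesis
        using that by (simp add: nonunits_closed)
    next
      case 2
      have "x = a \<otimes> (x \<otimes> w)"
        using that(1) by (simp add: 2 nonunits_closed m_comm)
      then have "y = a \<otimes> z"
        using that by simp
      then show ?thesis
        using 2 by (simp add: m_comm)
    qed
  qed
  have "x \<otimes> w \<in> \<P> \<longleftrightarrow> y \<otimes> w \<in> \<P>" if "w \<in> carrier Q" for w
    unfolding nonunit_mult_in_P_iff[OF x that] nonunit_mult_in_P_iff[OF y that]
  proof
    show "y \<otimes> w = z" if "x \<otimes> w = z"
      by (rule imp[OF x y]) (use assms \<open>w \<in> carrier Q\<close> that in blast)+
    show "x \<otimes> w = z" if "y \<otimes> w = z"
      by (rule imp[OF y x]) (use assms \<open>w \<in> carrier Q\<close> that in \<open>auto simp only:\<close>)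
  qed
  then have "(x, y) \<in> indist Q"
    using x y by (simp add: indist_def nonunits_closed)
  then show ?thesis
    using reduced_Q by (simp add: reduced_def Id_on_iff)
qed

text \<open>By \<open>nonunit_eqI\<close> a nonunit with component other than \<open>z\<close> and
  \<open>a \<otimes> z\<close> equals its component. Each of these two components admits just one
  nonunit outside the kernel, namely \<open>t\<close> and \<open>a \<otimes> t\<close>.\<close>

lemma element_cases:
  assumes t: "t \<in> nonunits" "t \<otimes> z = z" "t \<noteq> z" and x: "x \<in> carrier Q"
  shows "x \<in> {\<one>, a, t, a \<otimes> t} \<or> x \<otimes> z = x"
proof (cases "x \<in> nonunits")
  case False
  then show ?thesis
    using x by (auto simp: nonunits_def)
next
  case True
  have z: "z \<in> nonunits"
    using a_ne_z by (simp add: nonunits_def eq_commute)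
  have nonunit_mult: "w \<otimes> y \<in> nonunits" if "w \<in> nonunits" "y \<in> carrier Q" for w y
    using that nonunit_mult_ne_a[of w y] nonunit_mult_ne_a[of w "y \<otimes> a"]
    by (auto simp: nonunits_def simp flip: m_assoc)
  have t_closed: "t \<in> carrier Q"
    using t nonunits_closed by simp
  consider "x \<otimes> z = x" | "x \<otimes> z \<noteq> x" "x \<otimes> z = z" | "x \<otimes> z \<noteq> x" "x \<otimes> z = a \<otimes> z"
    | "x \<otimes> z \<noteq> z" "x \<otimes> z \<noteq> a \<otimes> z"
    by blast
  then show ?thesis
  proof cases
    case 2
    have "t \<noteq> a \<otimes> z" "x \<noteq> a \<otimes> z"
      using t(2) 2(2) az_ne_z by (force simp: m_assoc)+
    moreover have "x \<noteq> z"
      using 2(1) z_z by metis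
    ultimately have "x = t"
      using t 2(2) by (intro nonunit_eqI[OF True t(1)]) simp_all
    then show ?thesis
      by simp
  next
    case 3
    have ne: "a \<otimes> t \<noteq> a \<otimes> z"
      using t(3) a_a_left[OF t_closed] a_a_left[OF z_closed] by metis
    have atz: "(a \<otimes> t) \<otimes> z = a \<otimes> z"
      using t(2) t_closed by (simp add: m_assoc)
    then have "a \<otimes> t \<noteq> z"
      using z_z az_ne_z by metis
    moreover have "x \<noteq> z"
      using 3(1) z_z by metis
    moreover have "x \<noteq> a \<otimes> z"
    proof
      assume "x = a \<otimes> z"
      then have "x \<otimes> z = x"
        by (simp add: m_assoc)
      then show False
        using 3(1) by simp
    qed
    moreover have "a \<otimes> t \<in> nonunits"
      using nonunit_mult[OF t(1) a_closed] t_closed by (simp add: m_comm)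
    ultimately have "x = a \<otimes> t"
      using ne atz 3(2) by (intro nonunit_eqI[OF True]) simp_all
    then show ?thesis
      by simp
  next
    case 4
    have "x \<noteq> z" "x \<noteq> a \<otimes> z"
      using 4 by (auto simp: m_assoc)
    moreover have "x \<otimes> z \<otimes> z = x \<otimes> z"
      using x by (simp add: m_assoc)
    ultimately have "x = x \<otimes> z"
      using 4 by (intro nonunit_eqI[OF True nonunit_mult[OF True z_closed]]) simp_all
    then show ?thesis
      by simp
  qed simp
qed

end

section \<open>The one-stage extension\<close>

lemma carrier_R_bm: "carrier (R_bm n) = {E1, Ea, Et, Eat} \<union> Ez ` {..<2 ^ n}"
  by (auto simp: R_bm_def T_bm_def)

lemma R_bm_simps [simp]:
  "x \<otimes>\<^bsub>R_bm n\<^esub> y = elem_mult x y" "\<one>\<^bsub>R_bm n\<^esub> = E1" "\<P>\<^bsub>R_bm n\<^esub> = {Ea, Ez 0}"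
  by (simp_all add: R_bm_def T_bm_def)

lemma xor_nat_less_exp: "\<lbrakk>k < 2 ^ n; l < 2 ^ n\<rbrakk> \<Longrightarrow> k XOR l < (2 ^ n :: nat)"
  using take_bit_nat_less_exp[of n "k XOR l"] by (simp add: take_bit_nat_eq_self)

text \<open>The bound \<open>n \<ge> 1\<close> keeps \<open>Ez 1\<close> and the indices
  \<open>i XOR 1\<close> in range.\<close>

lemma elem_mult_closed:
  assumes "n \<ge> 1" "p \<in> carrier (R_bm n)" "q \<in> carrier (R_bm n)"
  shows "elem_mult p q \<in> carrier (R_bm n)"
proof -
  have one: "1 < (2 ^ n :: nat)"
    using assms(1) one_less_power[of "2 :: nat" n] by simp
  have "i XOR 1 < 2 ^ n" if "i < 2 ^ n" for i :: nat
    using that one by (rule xor_nat_less_exp)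
  then show ?thesis
    using assms one xor_nat_less_exp[of _ n]
    by (cases p; cases q) (auto simp: carrier_R_bm)
qed

context two_point_misere_quotient
begin

lemma one_stage_extension_R_iso:
  assumes n: "n \<ge> 1"
    and S: "submonoid S Q"
    and \<rho>_hom: "\<rho> \<in> bm_hom (sub_bm Q S) (R_bm n)"
    and \<rho>_surj: "\<rho> ` S = carrier (R_bm n)"
    and a: "a \<in> S" "\<rho> a = Ea" and z: "z \<in> S" "\<rho> z = Ez 0"
    and x: "x \<in> carrier Q - S" "(\<lambda>T. submonoid T Q) hull (S \<union> {x}) = carrier Q"
  shows "R_bm (n + 1) \<cong>\<^sub>b\<^sub>m Q"
proof -
  interpret S: submonoid S Q by fact
  have S_carrier: "s \<in> carrier Q" if "s \<in> S" for s
    using that S.subset by blast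
  have \<rho>_mult: "\<rho> (r \<otimes> s) = elem_mult (\<rho> r) (\<rho> s)" if "r \<in> S" "s \<in> S" for r s
    using \<rho>_hom that by (simp add: bm_hom_def hom_def sub_bm_def)
  have \<rho>_one: "\<rho> \<one> = E1"
    using \<rho>_hom by (simp add: bm_hom_def sub_bm_def)
  have \<rho>_P: "\<rho> s \<in> {Ea, Ez 0} \<longleftrightarrow> s \<in> \<P>" if "s \<in> S" for s
    using \<rho>_hom that by (simp add: bm_hom_def sub_bm_def)
  \<comment> \<open>Such an \<open>s\<close> lies in \<open>\<P> = {a, z}\<close>, and
    \<open>a\<close> has another image. Several products below are identified with \<open>z\<close>
    in this way.\<close>
  have \<rho>_z: "s = z" if "s \<in> S" "\<rho> s = Ez 0" for s
    using \<rho>_P[OF that(1)] that a by (auto simp: P_eq)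
  have ex_preimage: "\<exists>s\<in>S. \<rho> s = e" if "e \<in> carrier (R_bm n)" for e
    using that unfolding \<rho>_surj[symmetric] by blast

  obtain t where t: "t \<in> S" "\<rho> t = Et"
    using ex_preimage[of Et] by (auto simp: carrier_R_bm)
  have t_closed: "t \<in> carrier Q"
    using S_carrier t by simp
  have t_z: "t \<otimes> z = z"
    by (rule \<rho>_z) (simp_all add: \<rho>_mult t z)
  have t_t: "t \<otimes> t = z"
    by (rule \<rho>_z) (simp_all add: \<rho>_mult t)
  have t_nonunit: "t \<in> nonunits"
    using t t_closed a \<rho>_one by (auto simp: nonunits_def)
  have t_ne_z: "t \<noteq> z"
    using t z by auto
  note cases = element_cases[OF t_nonunit t_z t_ne_z]

  \<comment> \<open>Multiplication by \<open>z\<close> moves a preimage of \<open>Ez k\<close> into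
    the kernel without changing its image.\<close>
  have "\<exists>s. s \<in> S \<and> \<rho> s = Ez k \<and> s \<otimes> z = s" if k: "k < 2 ^ n" for k
  proof -
    obtain s where "s \<in> S" "\<rho> s = Ez k"
      using ex_preimage[of "Ez k"] k by (auto simp: carrier_R_bm)
    then show ?thesis
      by (intro exI[of _ "s \<otimes> z"]) (simp add: \<rho>_mult z S_carrier m_assoc)
  qed
  then obtain y where y: "\<And>k. k < 2 ^ n \<Longrightarrow> y k \<in> S" "\<And>k. k < 2 ^ n \<Longrightarrow> \<rho> (y k) = Ez k"
      "\<And>k. k < 2 ^ n \<Longrightarrow> y k \<otimes> z = y k"
    by metis
  have y_unique: "s = y k" if s: "s \<in> S" "\<rho> s = Ez k" "s \<otimes> z = s" and k: "k < 2 ^ n" for s k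
  proof -
    have "y k \<otimes> y k = z" "s \<otimes> y k = z"
      by (rule \<rho>_z; simp add: \<rho>_mult y k s)+
    moreover have "s \<otimes> (y k \<otimes> y k) = (s \<otimes> y k) \<otimes> y k"
      using s y(1)[OF k] by (simp add: S_carrier m_assoc)
    ultimately show ?thesis
      using s y(1,3)[OF k] by (simp add: m_comm S_carrier)
  qed
  have y_mult: "y k \<otimes> y l = y (k XOR l)" if kl: "k < 2 ^ n" "l < 2 ^ n" for k l
    by (rule y_unique)
      (use kl y in \<open>simp_all add: \<rho>_mult xor_nat_less_exp m_assoc S_carrier\<close>)
  have y_0: "y 0 = z"
    by (rule \<rho>_z) (simp_all add: y)
  have az_eq: "a \<otimes> z = y 1"
    using n one_less_power[of "2 :: nat" n] by (intro y_unique) (simp_all add: \<rho>_mult a z m_assoc)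

  have x_closed: "x \<in> carrier Q" and x_notin: "x \<notin> S"
    using x by auto
  \<comment> \<open>All elements outside the kernel lie in \<open>S\<close>, so the new generator is
    a kernel element.\<close>
  have "x \<notin> {\<one>, a, t, a \<otimes> t}"
    using x_notin a t by auto
  then have x_z: "x \<otimes> z = x"
    using cases[OF x_closed] by blast
  have x_x: "x \<otimes> x = z"
    using kernel_square[OF x_closed] x_z by simp

  \<comment> \<open>In the kernel \<open>e b\<close> is a power of \<open>x\<close> with exponent 0
    or 1. The low \<open>n\<close> bits of an index select an element of \<open>S\<close>, and bit
    \<open>n\<close> tells whether \<open>x\<close> is a factor.\<close>
  define e where "e = (\<lambda>b. if b then x else z)"
  define Y where "Y = (\<lambda>i. y (take_bit n i) \<otimes> e (bit i n))"
  have e_closed: "e b \<in> carrier Q" for b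
    using x_closed by (simp add: e_def)
  have e_mult: "e b \<otimes> e c = e (b \<noteq> c)" for b c
    using x_closed x_z x_x by (simp add: e_def m_comm[of z x])
  have take: "take_bit n i < 2 ^ n" for i :: nat
    by (rule take_bit_nat_less_exp)
  have y_closed: "y (take_bit n i) \<in> carrier Q" for i
    using y(1)[OF take] S_carrier by blast
  have Y_closed: "Y i \<in> carrier Q" for i
    using y_closed e_closed by (simp add: Y_def)
  have Y_mult: "Y i \<otimes> Y j = Y (i XOR j)" for i j
  proof -
    have "Y i \<otimes> Y j = (y (take_bit n i) \<otimes> y (take_bit n j)) \<otimes> (e (bit i n) \<otimes> e (bit j n))"
      using y_closed e_closed by (simp add: Y_def m_ac)
    then show ?thesis
      by (simp only: y_mult[OF take take] e_mult Y_def take_bit_xor bit_xor_iff)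
  qed
  have Y_small: "Y k = y k" if "k < 2 ^ n" for k
  proof -
    have "take_bit n k = k"
      using that by (simp add: take_bit_nat_eq_self)
    moreover from this have "\<not> bit k n"
      using bit_take_bit_iff[of n k n] by simp
    ultimately show ?thesis
      using y(3)[OF that] by (simp add: Y_def e_def)
  qed
  have Y_0: "Y 0 = z"
    using Y_small[of 0] y_0 by simp
  have Y_1: "Y 1 = a \<otimes> z"
    using Y_small[of 1] az_eq n one_less_power[of "2 :: nat" n] by simp
  have z_Y: "z \<otimes> Y i = Y i" for i
    using Y_mult[of 0 i] Y_0 by simp
  have a_Y: "a \<otimes> Y i = Y (i XOR 1)" for i
    using Y_mult[of 1 i] Y_1 z_Y[of i] by (simp add: m_assoc Y_closed xor.commute)
  have t_Y: "t \<otimes> Y i = Y i" for i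
  proof -
    have "(t \<otimes> z) \<otimes> Y i = t \<otimes> (z \<otimes> Y i)"
      by (simp add: m_assoc Y_closed t_closed)
    then show ?thesis
      by (simp add: t_z z_Y)
  qed
  have Y_inj: "i = j" if "Y i = Y j" "i < 2 ^ (n + 1)" "j < 2 ^ (n + 1)" for i j
  proof -
    \<comment> \<open>If the top bits differed, \<open>Y i \<otimes> Y j = z\<close> would read
      \<open>d \<otimes> x = z\<close> with \<open>d\<close> in \<open>S\<close> its own kernel
      inverse, so \<open>x = d\<close> would lie in \<open>S\<close>.\<close>
    have bits: "bit i n = bit j n"
    proof (rule ccontr)
      assume "bit i n \<noteq> bit j n"
      moreover define d where "d = y (take_bit n (i XOR j))"
      ultimately have "d \<otimes> x = z"
        using Y_mult[of i j] Y_mult[of j j] that(1) Y_0 by (simp add: Y_def e_def bit_xor_iff del: take_bit_xor)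
      moreover have d: "d \<in> S" "d \<in> carrier Q" "d \<otimes> d = z" "d \<otimes> z = d"
        using y(1,3)[OF take[of "i XOR j"]] y_closed[of "i XOR j"]
          y_mult[OF take[of "i XOR j"] take[of "i XOR j"]] y_0
        by (simp_all add: d_def del: take_bit_xor)
      moreover have "d \<otimes> (d \<otimes> x) = (d \<otimes> d) \<otimes> x"
        using d(2) x_closed by (simp add: m_assoc)
      ultimately have "x = d"
        using x_z x_closed by (simp add: m_comm[of z x])
      then show False
        using d(1) x_notin by simp
    qed
    have recover: "y (take_bit n i) = Y i \<otimes> e (bit i n)" for i
      using y_closed e_closed y(3)[OF take] by (simp add: Y_def m_assoc e_mult) (simp add: e_def)
    have "y (take_bit n i) = y (take_bit n j)"
      by (simp add: recover bits that(1))
    then have "take_bit n i = take_bit n j"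
      using y(2)[OF take] by (metis elem.inject)
    then have "take_bit (Suc n) i = take_bit (Suc n) j"
      using bits by (simp add: take_bit_Suc_from_most)
    then show ?thesis
      using that(2,3) by (simp add: take_bit_nat_eq_self)
  qed

  define f where "f = (\<lambda>p. case p of E1 \<Rightarrow> \<one> | Ea \<Rightarrow> a | Et \<Rightarrow> t | Eat \<Rightarrow> a \<otimes> t | Ez i \<Rightarrow> Y i)"
  have f_simps [simp]: "f E1 = \<one>" "f Ea = a" "f Et = t" "f Eat = a \<otimes> t" "f (Ez i) = Y i" for i
    by (simp_all add: f_def)
  have f_closed: "f p \<in> carrier Q" for p
    by (cases p) (simp_all add: Y_closed t_closed)
  have f_mult: "f (elem_mult p q) = f p \<otimes> f q" for p q
  proof -
    have t_t_left: "t \<otimes> (t \<otimes> s) = z \<otimes> s" if "s \<in> carrier Q" for s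
      using that t_closed t_t by (simp flip: m_assoc)
    have "Y i \<otimes> a = Y (i XOR 1)" "Y i \<otimes> t = Y i" for i
      using a_Y t_Y by (simp_all add: m_comm Y_closed t_closed)
    moreover have "Y i \<otimes> (a \<otimes> t) = Y (i XOR 1)" for i
      using calculation by (simp add: Y_closed t_closed flip: m_assoc)
    ultimately show ?thesis
      using a_Y t_Y
      by (cases p; cases q)
        (simp_all add: Y_closed t_closed Y_mult m_assoc t_t t_t_left Y_0 Y_1[simplified]
           m_comm[of t a] m_lcomm[of t a])
  qed
  \<comment> \<open>This separates the kernel from the other four elements, so injectivity can be
    checked on each side.\<close>
  have f_z: "f p \<otimes> z = f p \<longleftrightarrow> p \<in> range Ez" for p
  proof -
    have "a \<otimes> t \<noteq> a \<otimes> z"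
      using t_ne_z a_a_left[OF t_closed] a_a_left[OF z_closed] by metis
    moreover have "Y i \<otimes> z = Y i" for i
      using z_Y by (simp add: m_comm Y_closed)
    moreover have "a \<otimes> z \<noteq> a"
      using z_mult_ne_a[of a] by (simp add: m_comm)
    ultimately show ?thesis
      using z_ne_one t_ne_z by (cases p) (auto simp: m_assoc t_closed t_z)
  qed
  have f_inj: "inj_on f (carrier (R_bm (n + 1)))"
  proof (rule inj_onI)
    fix p q
    assume p: "p \<in> carrier (R_bm (n + 1))" and q: "q \<in> carrier (R_bm (n + 1))" and eq: "f p = f q"
    show "p = q"
    proof (cases "p \<in> range Ez")
      case True
      moreover have "q \<in> range Ez"
        using True f_z[of p] f_z[of q] eq by simp
      ultimately obtain i j where "p = Ez i" "q = Ez j"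
        by blast
      then show ?thesis
        using p q eq Y_inj[of i j] by (auto simp: carrier_R_bm)
    next
      case False
      \<comment> \<open>The four elements outside the kernel lie in \<open>S\<close>, where
        \<open>\<rho>\<close> inverts \<open>f\<close>.\<close>
      have *: "\<rho> (f r) = r" if "r \<notin> range Ez" for r
        using that a t by (cases r) (auto simp: \<rho>_mult \<rho>_one)
      have "q \<notin> range Ez"
        using False f_z[of p] f_z[of q] eq by simp
      then show ?thesis
        using *[of p] *[of q] False eq by metis
    qed
  qed
  have f_surj: "f ` carrier (R_bm (n + 1)) = carrier Q"
  proof
    show "f ` carrier (R_bm (n + 1)) \<subseteq> carrier Q"
      using f_closed by blast
    have "submonoid (f ` carrier (R_bm (n + 1))) Q"
    proof (rule submonoid.intro)
      show "f ` carrier (R_bm (n + 1)) \<subseteq> carrier Q"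
        using f_closed by blast
      show "\<one> \<in> f ` carrier (R_bm (n + 1))"
        by (rule image_eqI[of _ _ E1]) (simp_all add: carrier_R_bm)
      show "u \<otimes> v \<in> f ` carrier (R_bm (n + 1))"
        if "u \<in> f ` carrier (R_bm (n + 1))" "v \<in> f ` carrier (R_bm (n + 1))" for u v
        using that elem_mult_closed[of "n + 1"] by (auto simp flip: f_mult)
    qed
    moreover have "S \<union> {x} \<subseteq> f ` carrier (R_bm (n + 1))"
    proof -
      have "s \<in> f ` carrier (R_bm (n + 1))" if s: "s \<in> S" for s
      proof (cases "s \<otimes> z = s")
        case True
        then have "elem_mult (\<rho> s) (Ez 0) = \<rho> s"
          using \<rho>_mult[OF s z(1)] z by simp
        then obtain k where k: "\<rho> s = Ez k"
          by (cases "\<rho> s") auto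
        moreover have "\<rho> s \<in> carrier (R_bm n)"
          using s \<rho>_surj by blast
        ultimately have "k < 2 ^ n"
          by (auto simp: carrier_R_bm)
        then have "s = f (Ez k)"
          using y_unique[OF s k True] Y_small by simp
        then show ?thesis
          by (rule image_eqI) (use \<open>k < 2 ^ n\<close> in \<open>simp add: carrier_R_bm\<close>)
      next
        case False
        then have "s \<in> f ` {E1, Ea, Et, Eat}"
          using cases[OF S_carrier[OF s]] by simp
        then show ?thesis
          unfolding carrier_R_bm by blast
      qed
      \<comment> \<open>The index \<open>2 ^ n\<close> has zero low bits and bit \<open>n\<close>
        set, so its value is \<open>z \<otimes> x\<close>.\<close>
      moreover have "x = f (Ez (2 ^ n))"
        using x_z x_closed by (simp add: Y_def e_def y_0 bit_exp_iff m_comm[of z x] take_bit_eq_mod)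
      then have "x \<in> f ` carrier (R_bm (n + 1))"
        by (rule image_eqI) (simp add: carrier_R_bm)
      ultimately show ?thesis
        by blast
    qed
    ultimately have "(\<lambda>T. submonoid T Q) hull (S \<union> {x}) \<subseteq> f ` carrier (R_bm (n + 1))"
      by (intro hull_minimal)
    then show "carrier Q \<subseteq> f ` carrier (R_bm (n + 1))"
      using x(2) by simp
  qed
  have "f \<in> iso (R_bm (n + 1)) Q"
    using f_closed f_mult f_inj f_surj by (auto simp: iso_def hom_def bij_betw_def)
  moreover have "f ` \<P>\<^bsub>R_bm (n + 1)\<^esub> = \<P>"
    using Y_0 by (simp add: P_eq)
  ultimately show ?thesis
    unfolding bm_iso_def by blast
qed

end

theorem theorem4p2:
  fixes n :: nat and Q :: "'a bip_monoid"
  assumes "n \<ge> 2"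
    and "is_misere_quotient Q"
    and "one_stage_extension Q (R_bm n)"
    and "card (distinguished Q) = 2"
  shows "Q \<cong>\<^sub>b\<^sub>m R_bm (n + 1)"
proof -
  obtain S x where ext: "extension_via Q (R_bm n) S" and x: "x \<in> carrier Q - S"
      "(\<lambda>T. submonoid T Q) hull (S \<union> {x}) = carrier Q"
    using assms(3) by (auto simp: one_stage_extension_def)
  interpret Q: bipartite_monoid Q
    using assms(2) by (simp add: is_misere_quotient_def)
  interpret S: submonoid S Q
    using ext by (simp add: extension_via_def)
  interpret R: bipartite_monoid "R_bm n"
    using ext by (simp add: extension_via_def)
  have reduced: "reduced Q"
    using ext by (simp add: extension_via_def)

  obtain A where A: "closed_games A" "Q \<cong>\<^sub>b\<^sub>m misere_quotient_of A"
    using assms(2) by (auto simp: is_misere_quotient_def)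
  obtain \<Phi> where \<Phi>: "\<Phi> \<in> bm_hom (games_bm A) Q" "\<Phi> ` A = carrier Q"
    using misere_quotient_projection[OF A(1) Q.monoid_axioms
        bm_iso_sym[OF A(2) Q.m_closed Q.distinguished_subset]] .
  have \<Phi>_sum: "\<Phi> (game_sum G H) = \<Phi> G \<otimes>\<^bsub>Q\<^esub> \<Phi> H" if "G \<in> A" "H \<in> A" for G H
    using \<Phi>(1) that by (simp add: bm_hom_def games_bm_def hom_def)
  have \<Phi>_zero: "\<Phi> zero_game = \<one>\<^bsub>Q\<^esub>"
    using \<Phi>(1) by (simp add: bm_hom_def games_bm_def)
  have \<Phi>_P: "\<Phi> G \<in> \<P>\<^bsub>Q\<^esub> \<longleftrightarrow> misere_P G" if "G \<in> A" for G
    using \<Phi>(1) that by (simp add: bm_hom_def games_bm_def)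
  have A_sum: "game_sum G H \<in> A" if "G \<in> A" "H \<in> A" for G H
    using A(1) that by (simp add: closed_games_def)
  have \<Phi>_closed: "\<Phi> G \<in> carrier Q" if "G \<in> A" for G
    using \<Phi>(2) that by blast

  have S_carrier: "s \<in> carrier Q" if "s \<in> S" for s
    using that S.subset by blast
  have "comm_monoid (sub_bm Q S)"
    by (rule comm_monoidI) (simp_all add: sub_bm_def S_carrier Q.m_ac)
  moreover have "\<P>\<^bsub>sub_bm Q S\<^esub> \<subseteq> carrier (sub_bm Q S)"
    by (simp add: sub_bm_def)
  moreover have "reduction (sub_bm Q S) \<cong>\<^sub>b\<^sub>m R_bm n"
    using ext by (simp add: extension_via_def)
  ultimately obtain \<rho> where \<rho>: "\<rho> \<in> bm_hom (sub_bm Q S) (R_bm n)"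
      "\<rho> ` carrier (sub_bm Q S) = carrier (R_bm n)"
    using reduction_projection[OF _ R.monoid_axioms] by metis
  have \<rho>_mult: "\<rho> (r \<otimes>\<^bsub>Q\<^esub> s) = elem_mult (\<rho> r) (\<rho> s)" if "r \<in> S" "s \<in> S" for r s
    using \<rho>(1) that by (simp add: bm_hom_def hom_def sub_bm_def)
  have \<rho>_one: "\<rho> \<one>\<^bsub>Q\<^esub> = E1"
    using \<rho>(1) by (simp add: bm_hom_def sub_bm_def)
  have \<rho>_P: "\<rho> s \<in> {Ea, Ez 0} \<longleftrightarrow> s \<in> \<P>\<^bsub>Q\<^esub>" if "s \<in> S" for s
    using \<rho>(1) that by (simp add: bm_hom_def sub_bm_def)
  have \<rho>_surj: "\<rho> ` S = carrier (R_bm n)"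
    using \<rho>(2) by (simp add: sub_bm_def)

  have "Ea \<in> \<rho> ` S" "Ez 0 \<in> \<rho> ` S"
    by (simp_all add: \<rho>_surj carrier_R_bm)
  then obtain a z where a: "a \<in> S" "\<rho> a = Ea" and z: "z \<in> S" "\<rho> z = Ez 0"
    by (metis imageE)
  have "{a, z} \<subseteq> \<P>\<^bsub>Q\<^esub>" "a \<noteq> z"
    using \<rho>_P a z by auto
  moreover have "finite \<P>\<^bsub>Q\<^esub>"
    using assms(4) by (intro card_ge_0_finite) simp
  ultimately have P: "\<P>\<^bsub>Q\<^esub> = {a, z}"
    using card_subset_eq[of "\<P>\<^bsub>Q\<^esub>" "{a, z}"] assms(4) by simp
  have \<rho>_z: "s = z" if "s \<in> S" "\<rho> s = Ez 0" for s
    using \<rho>_P[OF that(1)] that a P by auto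

  \<comment> \<open>A game of value \<open>a\<close> is a P-position, hence nonzero, which puts
    \<open>star\<close> into \<open>A\<close>.\<close>
  obtain G where G: "G \<in> A" "\<Phi> G = a"
    using \<Phi>(2) a(1) S.subset by (metis imageE subsetD)
  then have "G \<noteq> zero_game"
    using \<Phi>_P[OF G(1)] P not_misere_P_zero by auto
  then have star: "star \<in> A"
    using star_in_closed_games A(1) G by blast
  have "\<Phi> star \<in> {a, z}"
    using \<Phi>_P[OF star] misere_P_star P by simp
  have star_star: "\<Phi> star \<otimes>\<^bsub>Q\<^esub> \<Phi> star = \<one>\<^bsub>Q\<^esub>"
  proof -
    have "\<Phi> (game_sum star star) \<otimes>\<^bsub>Q\<^esub> w \<in> \<P>\<^bsub>Q\<^esub> \<longleftrightarrow> w \<in> \<P>\<^bsub>Q\<^esub>" if w: "w \<in> carrier Q" for w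
    proof -
      obtain X where X: "X \<in> A" "\<Phi> X = w"
        using w \<Phi>(2) by (metis imageE)
      then show ?thesis
        using \<Phi>_P[of "game_sum (game_sum star star) X"] \<Phi>_P[of X] star misere_P_add_star_star
        by (simp add: \<Phi>_sum A_sum)
    qed
    then have "(\<Phi> (game_sum star star), \<one>\<^bsub>Q\<^esub>) \<in> indist Q"
      using star by (simp add: indist_def \<Phi>_closed A_sum)
    then show ?thesis
      using reduced star by (simp add: reduced_def Id_on_iff \<Phi>_sum)
  qed
  \<comment> \<open>The square of \<open>z\<close> maps to \<open>Ez 0\<close>, that of
    \<open>\<Phi> star\<close> to \<open>E1\<close>. This leaves
    \<open>\<Phi> star = a\<close>.\<close>
  have "\<Phi> star \<noteq> z"
    using star_star \<rho>_mult[OF z(1) z(1)] z \<rho>_one by auto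
  then have a_a: "a \<otimes>\<^bsub>Q\<^esub> a = \<one>\<^bsub>Q\<^esub>"
    using \<open>\<Phi> star \<in> {a, z}\<close> star_star by auto

  interpret two_point_misere_quotient Q A \<Phi> a z
  proof
    show "z \<otimes>\<^bsub>Q\<^esub> z = z"
      by (rule \<rho>_z) (simp_all add: \<rho>_mult z)
    show "z \<noteq> \<one>\<^bsub>Q\<^esub>"
      using z \<rho>_one by auto
    show "a \<otimes>\<^bsub>Q\<^esub> z \<noteq> z"
      using \<rho>_mult[OF a(1) z(1)] a z by auto
  qed (simp_all add: A \<Phi> reduced P S_carrier a z a_a)
  have "n \<ge> 1"
    using assms(1) by simp
  then have "R_bm (n + 1) \<cong>\<^sub>b\<^sub>m Q"
    using one_stage_extension_R_iso[OF _ S.submonoid_axioms \<rho>(1) \<rho>_surj a z x] by blast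
  then show ?thesis
  proof (rule bm_iso_sym)
    show "p \<otimes>\<^bsub>R_bm (n + 1)\<^esub> q \<in> carrier (R_bm (n + 1))"
      if "p \<in> carrier (R_bm (n + 1))" "q \<in> carrier (R_bm (n + 1))" for p q
      using elem_mult_closed[OF _ that] by simp
    show "\<P>\<^bsub>R_bm (n + 1)\<^esub> \<subseteq> carrier (R_bm (n + 1))"
      by (simp add: carrier_R_bm)
  qed
qed

end
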